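(* For all integers $0<m<n<\infty$, there exists an antipode preserving continuous surjection $\psi_{m,n}:\mathbb{S}^m\to\mathbb{S}^n$, i.e., a continuous surjective map with $\psi_{m,n}(-x)=-\psi_{m,n}(x)$ for every $x\in\mathbb{S}^m$.
   Context: For an integer $m\ge 0$, $\mathbb{S}^m=\{x\in\mathbb{R}^{m+1}:\|x\|=1\}$ is the unit sphere. *)

theory Defs
  imports "HOL-Analysis.Analysis"
begin

end

theory Submission
  imports Defs
begin

text \<open>
  An odd map into \<open>S\<^sup>n\<close> is obtained by normalizing an odd map \<open>F\<close> on \<open>S\<^sup>m\<close> with values in
  \<open>\<real>\<^bsup>n+1\<^esup> - {0}\<close>; by oddness the normalized
  map is onto as soon as its image contains the closed upper hemisphere
  (\<open>odd_surjection_by_normalization\<close>). The map used here is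
  \<open>F x = max 0 (1 - 2 |x\<^sub>0|) x + x\<^sub>0 p (max 0 (2 |x\<^sub>0| - 1))\<close>,
  where \<open>p\<close> is a continuous curve of nonzero vectors that starts at the pole \<open>e\<^sub>0\<close> and
  runs through every direction of the closed upper hemisphere.

  \<open>F\<close> is odd, because \<open>x\<close> and the factor \<open>x\<^sub>0\<close> are odd and everything else depends on
  \<open>|x\<^sub>0|\<close> only. It has no zero: for \<open>x\<^sub>0 = 0\<close> it is the inclusion of the equator, for
  \<open>0 < |x\<^sub>0| < 1/2\<close> both summands have a \<open>0\<close>-th coordinate with the sign of \<open>x\<^sub>0\<close>, and for
  \<open>|x\<^sub>0| \<ge> 1/2\<close> only a nonzero multiple of a value of \<open>p\<close> is left. In this last range
  \<open>F x\<close> depends on \<open>x\<^sub>0\<close> alone, and \<open>x\<^sub>0\<close> running from \<open>1/2\<close> to \<open>1\<close> already yields all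
  directions of the upper hemisphere. Positivity of \<open>m\<close> enters in that the latitude
  \<open>x\<^sub>0\<close> takes all values in \<open>[-1, 1]\<close> on \<open>S\<^sup>m\<close>.

  The curve \<open>p\<close> comes from a curve \<open>\<gamma>\<close> that fills the cube \<open>[-1, 1]\<^sup>n\<close> and starts at
  \<open>0\<close> (\<open>cube_curve_onto\<close>): take \<open>p = (1 - |\<gamma>\<^sub>1| - \<dots> - |\<gamma>\<^sub>n|, \<gamma>\<^sub>1, \<dots>, \<gamma>\<^sub>n)\<close>, which meets
  every ray of the upper hemisphere where that ray crosses the unit sphere of the
  \<open>l\<^sup>1\<close>-norm (\<open>cap_curve_directions\<close>). The filling curve is Schoenberg's: a suitable periodic
  function evaluated at \<open>3\<^sup>j t\<close> reads off the \<open>j\<close>-th ternary digit of a point \<open>t\<close> of the Cantor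
  set, and these digits are distributed among the binary expansions of the coordinates.
\<close>

section \<open>A continuous curve through the Hilbert cube\<close>

text \<open>
  An even function of period \<open>2\<close> that is \<open>0\<close> on \<open>[0, 1/3]\<close> and \<open>1\<close> on \<open>[2/3, 1]\<close>. The cosine
  gives continuity and periodicity for free; clipping flattens it on the two intervals.
\<close>
definition plateau :: "real \<Rightarrow> real" where
  "plateau t = min 1 (max 0 (1/2 - cos (pi * t)))"

lemma plateau_range: "0 \<le> plateau t" "plateau t \<le> 1"
  by (auto simp: plateau_def)

lemma continuous_on_plateau [continuous_intros]:
  fixes f :: "real \<Rightarrow> real"
  shows "continuous_on S f \<Longrightarrow> continuous_on S (\<lambda>x. plateau (f x))"
  unfolding plateau_def by (intro continuous_intros)

lemma plateau_0: "plateau 0 = 0"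
  by (simp add: plateau_def)

lemma plateau_periodic: "plateau (2 * of_int k + t) = plateau t"
proof -
  have "cos (pi * (2 * of_int k + t)) = cos (pi * t + (2 * pi) * of_int k)"
    by (simp add: algebra_simps)
  also have "\<dots> = cos (pi * t)"
    by (simp add: cos_add sin_int_2pin cos_int_2pin)
  finally show ?thesis by (simp add: plateau_def)
qed

lemma plateau_low:
  assumes "0 \<le> t" "t \<le> 1/3"
  shows "plateau t = 0"
proof -
  have "cos (pi/3) \<le> cos (pi * t)"
    using assms by (intro cos_monotone_0_pi_le) auto
  then show ?thesis by (simp add: plateau_def cos_60)
qed

lemma plateau_high:
  assumes "2/3 \<le> t" "t \<le> 1"
  shows "plateau t = 1"
proof -
  have "cos (pi * t) \<le> cos (2 * pi/3)"
    using assms by (intro cos_monotone_0_pi_le) (auto simp: field_simps)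
  moreover have "cos (2 * pi/3) = -1/2"
    by (simp add: cos_120)
  ultimately show ?thesis by (simp add: plateau_def)
qed

text \<open>
  The point is \<open>t = \<Sum>\<^sub>k 2 b\<^sub>k / 3\<^bsup>k+1\<^esup>\<close> in the Cantor set. In \<open>3\<^sup>j t\<close> the digits before the
  \<open>j\<close>-th contribute an even integer, which the period of \<open>plateau\<close> absorbs; the rest lies in
  \<open>[0, 1/3]\<close> or \<open>[2/3, 1]\<close> according to the digit \<open>b\<^sub>j\<close>.
\<close>
lemma cantor_point_with_digits:
  fixes b :: "nat \<Rightarrow> bool"
  obtains t :: real where "0 \<le> t" "t \<le> 1"
    "\<And>j. plateau (3 ^ j * t) = of_bool (b j)"
proof -
  \<comment> \<open>\<open>T j\<close> is the point whose digit sequence is \<open>b\<close> shifted by \<open>j\<close> places, which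
    is \<open>3\<^sup>j t\<close> up to an even integer.\<close>
  define T :: "nat \<Rightarrow> real" where
    "T j = (\<Sum>k. 2 / 3 * of_bool (b (j + k)) * (1/3) ^ k)" for j
  have geo: "summable (\<lambda>k. 2 / 3 * (1/3 :: real) ^ k)"
    by (intro summable_mult summable_geometric) auto
  have summ: "summable (\<lambda>k. 2 / 3 * of_bool (b (j + k)) * (1/3 :: real) ^ k)" for j
    by (rule summable_comparison_test'[OF geo, of 0]) auto
  have T_nonneg: "0 \<le> T j" for j
    unfolding T_def by (intro suminf_nonneg summ) auto
  have T_le: "T j \<le> 1" for j
  proof -
    have "T j \<le> (\<Sum>k. 2 / 3 * (1/3 :: real) ^ k)"
      unfolding T_def by (intro suminf_le summ geo) auto
    also have "\<dots> = 1"
      by (subst suminf_mult) (auto simp: suminf_geometric summable_geometric)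
    finally show ?thesis .
  qed
  have shift: "T j = (2 * of_bool (b j) + T (Suc j)) / 3" for j
  proof -
    have "(\<Sum>k. 2 / 3 * of_bool (b (j + Suc k)) * (1/3) ^ Suc k) = T j - 2 / 3 * of_bool (b j)"
      unfolding T_def using suminf_split_head[OF summ[of j]] by simp
    moreover have "(\<Sum>k. 2 / 3 * of_bool (b (j + Suc k)) * (1/3) ^ Suc k) = T (Suc j) * (1/3)"
      unfolding T_def by (subst suminf_mult2[OF summ]) (simp add: mult.assoc mult.commute)
    ultimately show ?thesis by simp
  qed
  have "\<exists>k::int. 3 ^ j * T 0 = 2 * of_int k + T j" for j
  proof (induction j)
    case 0
    show ?case by (intro exI[of _ 0]) simp
  next
    case (Suc j)
    then obtain k :: int where "3 ^ j * T 0 = 2 * of_int k + T j" by blast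
    then have "3 ^ Suc j * T 0 = 6 * of_int k + 3 * T j"
      by simp
    also have "\<dots> = 2 * of_int (3 * k + of_bool (b j)) + T (Suc j)"
      unfolding shift[of j] by simp
    finally show ?case by blast
  qed
  then have "plateau (3 ^ j * T 0) = plateau (T j)" for j
    by (metis plateau_periodic)
  moreover have "plateau (T j) = of_bool (b j)" for j
    using shift[of j] T_nonneg[of "Suc j"] T_le[of "Suc j"]
    by (cases "b j") (auto intro: plateau_low plateau_high)
  ultimately show ?thesis
    using that[of "T 0"] T_nonneg T_le by metis
qed

text \<open>
  The digits are produced greedily by the doubling map. Its remainders \<open>r\<close> stay in the closed
  interval \<open>[0, 1]\<close>, so that \<open>u = 1\<close> is covered with all digits equal to one.
\<close>
lemma binary_expansion:
  fixes u :: real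
  assumes "0 \<le> u" "u \<le> 1"
  obtains b :: "nat \<Rightarrow> bool" where "(\<lambda>k. of_bool (b k) * (1/2) ^ Suc k) sums u"
proof -
  define r where "r k = ((\<lambda>s. 2 * s - of_bool (s \<ge> 1/2)) ^^ k) u" for k
  define b where "b k = (r k \<ge> 1/2)" for k
  have r_Suc: "r (Suc k) = 2 * r k - of_bool (b k)" for k
    by (simp add: r_def b_def)
  have r_range: "0 \<le> r k \<and> r k \<le> 1" for k
  proof (induction k)
    case 0
    then show ?case using assms by (simp add: r_def)
  next
    case (Suc k)
    then show ?case by (auto simp: r_Suc b_def)
  qed
  have partial: "(\<Sum>k<N. of_bool (b k) * (1/2) ^ Suc k) = u - r N * (1/2) ^ N" for N
  proof (induction N)
    case 0
    show ?case by (simp add: r_def)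
  next
    case (Suc N)
    have "of_bool (b N) * (1/2) ^ Suc N - r N * (1/2) ^ N = - r (Suc N) * (1/2 :: real) ^ Suc N"
      by (simp add: r_Suc algebra_simps)
    with Suc show ?case by (simp del: power_Suc)
  qed
  have "(\<lambda>N. r N * (1/2) ^ N) \<longlonglongrightarrow> 0"
  proof (rule tendsto_sandwich[OF _ _ tendsto_const])
    show "(\<lambda>N. (1/2 :: real) ^ N) \<longlonglongrightarrow> 0"
      by (intro LIMSEQ_power_zero) auto
  qed (use r_range in \<open>auto intro!: always_eventually mult_left_le_one_le\<close>)
  then have "(\<lambda>N. u - r N * (1/2) ^ N) \<longlonglongrightarrow> u - 0"
    by (intro tendsto_intros)
  then show ?thesis
    using that[of b] by (simp add: sums_def partial del: power_Suc)
qed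

text \<open>
  Pairing the coordinate \<open>i\<close> with the binary place \<open>k\<close> gives each coordinate its own
  infinite subsequence of the ternary digits of \<open>t\<close>, so that one curve serves countably many
  coordinates at once.
\<close>
definition schoenberg :: "nat \<Rightarrow> real \<Rightarrow> real" where
  "schoenberg i t = (\<Sum>k. plateau (3 ^ prod_encode (i, k) * t) * (1/2) ^ Suc k)"

lemma continuous_on_schoenberg: "continuous_on S (schoenberg i)"
proof -
  define f where "f k t = plateau (3 ^ prod_encode (i, k) * t) * (1/2) ^ Suc k" for k t
  have "uniform_limit S (\<lambda>n t. \<Sum>k<n. f k t) (\<lambda>t. \<Sum>k. f k t) sequentially"
  proof (rule Weierstrass_m_test)
    show "norm (f k t) \<le> (1/2) ^ Suc k" for k t
      using plateau_range by (auto simp: f_def intro: mult_left_le_one_le)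
    show "summable (\<lambda>k. (1/2 :: real) ^ Suc k)"
      by (subst summable_Suc_iff) (auto intro: summable_geometric)
  qed
  then have "continuous_on S (\<lambda>t. \<Sum>k. f k t)"
    by (rule uniform_limit_theorem[rotated])
       (auto simp: f_def intro!: always_eventually continuous_intros)
  then show ?thesis
    by (simp add: f_def schoenberg_def[abs_def])
qed

lemma schoenberg_0: "schoenberg i 0 = 0"
  by (simp add: schoenberg_def plateau_0)

lemma schoenberg_onto_Hilbert_cube:
  assumes "\<And>i. 0 \<le> u i" "\<And>i. u i \<le> 1"
  obtains t where "0 \<le> t" "t \<le> 1" "\<And>i. schoenberg i t = u i"
proof -
  have "\<exists>b :: nat \<Rightarrow> bool. (\<lambda>k. of_bool (b k) * (1/2) ^ Suc k) sums u i" for i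
    using binary_expansion assms by metis
  then obtain B :: "nat \<Rightarrow> nat \<Rightarrow> bool"
    where B: "\<And>i. (\<lambda>k. of_bool (B i k) * (1/2) ^ Suc k) sums u i"
    by metis
  obtain t where t: "0 \<le> t" "t \<le> 1"
      "\<And>j. plateau (3 ^ j * t) = of_bool (case_prod B (prod_decode j))"
    using cantor_point_with_digits[of "\<lambda>j. case_prod B (prod_decode j)"] by blast
  have "schoenberg i t = u i" for i
    using B[of i, THEN sums_unique] by (simp add: schoenberg_def t(3))
  with t(1,2) show ?thesis by (rule that)
qed

text \<open>
  Schoenberg's curve starts in the corner \<open>0\<close> of \<open>[0, 1]\<^sup>\<omega>\<close>. Differences of pairs of its coordinates
  give a curve that still fills a cube but starts at its centre.
\<close>
definition cube_curve :: "nat \<Rightarrow> real \<Rightarrow> real" where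
  "cube_curve i t = schoenberg (2 * i) t - schoenberg (2 * i + 1) t"

lemma continuous_on_cube_curve: "continuous_on S (cube_curve i)"
  unfolding cube_curve_def[abs_def]
  by (intro continuous_intros continuous_on_schoenberg)

lemma cube_curve_0: "cube_curve i 0 = 0"
  by (simp add: cube_curve_def schoenberg_0)

lemma cube_curve_onto:
  assumes "\<And>i. \<bar>w i\<bar> \<le> 1"
  obtains t where "0 \<le> t" "t \<le> 1" "\<And>i. cube_curve i t = w i"
proof -
  \<comment> \<open>Positive and negative parts of \<open>w i\<close> are the targets at places \<open>2 * i\<close> and \<open>2 * i + 1\<close>.\<close>
  define u where "u j = max 0 (if even j then w (j div 2) else - w (j div 2))" for j
  have "0 \<le> u j" "u j \<le> 1" for j
    using assms[of "j div 2"] by (auto simp: u_def)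
  then obtain t where t: "0 \<le> t" "t \<le> 1" "\<And>j. schoenberg j t = u j"
    using schoenberg_onto_Hilbert_cube by metis
  have "cube_curve i t = w i" for i
    by (simp add: cube_curve_def t(3) u_def)
  with t(1,2) show ?thesis by (rule that)
qed

section \<open>Odd maps between spheres\<close>

lemma in_nsphere_iff:
  "x \<in> topspace (nsphere n) \<longleftrightarrow> (\<forall>i>n. x i = 0) \<and> (\<Sum>i\<le>n. (x i)\<^sup>2) = 1"
  by (auto simp: nsphere)

text \<open>
  Normalizing turns \<open>F\<close> into a map of spheres that takes \<open>x\<close> to \<open>y\<close> whenever \<open>F x\<close> is a positive
  multiple of \<open>y\<close>. A point of the lower hemisphere is the antipode of one in the upper
  hemisphere, hence it is reached from the antipode of a preimage.
\<close>
lemma odd_surjection_by_normalization: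
  fixes F :: "(nat \<Rightarrow> real) \<Rightarrow> nat \<Rightarrow> real"
  assumes cont: "\<And>i. continuous_map (nsphere m) euclideanreal (\<lambda>x. F x i)"
    and supp: "\<And>x i. x \<in> topspace (nsphere m) \<Longrightarrow> n < i \<Longrightarrow> F x i = 0"
    and nz: "\<And>x. x \<in> topspace (nsphere m) \<Longrightarrow> \<exists>i\<le>n. F x i \<noteq> 0"
    and odd: "\<And>x. x \<in> topspace (nsphere m) \<Longrightarrow> F (\<lambda>i. - x i) = (\<lambda>i. - F x i)"
    and onto: "\<And>y. y \<in> topspace (nsphere n) \<Longrightarrow> 0 \<le> y 0 \<Longrightarrow>
                 \<exists>x \<in> topspace (nsphere m). \<exists>c>0. F x = (\<lambda>i. c * y i)"
  shows "\<exists>\<psi>. continuous_map (nsphere m) (nsphere n) \<psi>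
           \<and> \<psi> ` topspace (nsphere m) = topspace (nsphere n)
           \<and> (\<forall>x \<in> topspace (nsphere m). \<psi> (\<lambda>i. - x i) = (\<lambda>i. - \<psi> x i))"
proof -
  define N where "N x = sqrt (\<Sum>i\<le>n. (F x i)\<^sup>2)" for x
  define \<psi> where "\<psi> x = (\<lambda>i. F x i / N x)" for x
  have N_pos: "0 < N x" if x: "x \<in> topspace (nsphere m)" for x
  proof -
    obtain i where "i \<le> n" "F x i \<noteq> 0" using nz[OF x] by blast
    then have "0 < (\<Sum>i\<le>n. (F x i)\<^sup>2)"
      by (intro sum_pos2[of _ i]) auto
    then show ?thesis by (simp add: N_def)
  qed
  have \<psi>_in: "\<psi> x \<in> topspace (nsphere n)" if x: "x \<in> topspace (nsphere m)" for x
  proof -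
    have "(\<Sum>i\<le>n. (\<psi> x i)\<^sup>2) = (\<Sum>i\<le>n. (F x i)\<^sup>2) / (N x)\<^sup>2"
      by (simp add: \<psi>_def power_divide sum_divide_distrib)
    also have "\<dots> = 1"
      using N_pos[OF x] by (simp add: N_def sum_nonneg)
    finally show ?thesis
      using supp[OF x] by (simp add: in_nsphere_iff \<psi>_def)
  qed
  have "continuous_map (nsphere m) euclideanreal (\<lambda>x. \<psi> x i)" for i
    unfolding \<psi>_def
  proof (rule continuous_map_real_divide)
    show "continuous_map (nsphere m) euclideanreal N"
      unfolding N_def by (intro continuous_intros cont) auto
  qed (use cont N_pos in force)+
  then have cont_\<psi>: "continuous_map (nsphere m) (nsphere n) \<psi>"
    using \<psi>_in unfolding nsphere[of n]
    by (auto simp: continuous_map_in_subtopology continuous_map_componentwise_UNIV)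
  have odd_\<psi>: "\<psi> (\<lambda>i. - x i) = (\<lambda>i. - \<psi> x i)" if "x \<in> topspace (nsphere m)" for x
    using odd[OF that] by (simp add: \<psi>_def N_def fun_eq_iff)
  have upper: "\<exists>x \<in> topspace (nsphere m). \<psi> x = y"
    if y: "y \<in> topspace (nsphere n)" "0 \<le> y 0" for y
  proof -
    obtain x c where x: "x \<in> topspace (nsphere m)" "c > 0" "F x = (\<lambda>i. c * y i)"
      using onto[OF y] by blast
    have "(\<Sum>i\<le>n. (F x i)\<^sup>2) = c\<^sup>2 * (\<Sum>i\<le>n. (y i)\<^sup>2)"
      by (simp add: x(3) power_mult_distrib sum_distrib_left)
    then have "N x = c"
      using y(1) x(2) by (simp add: N_def in_nsphere_iff)
    then show ?thesis
      using x by (intro bexI[of _ x]) (auto simp: \<psi>_def)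
  qed
  have "\<exists>x \<in> topspace (nsphere m). \<psi> x = y" if y: "y \<in> topspace (nsphere n)" for y
  proof (cases "0 \<le> y 0")
    case True
    with y show ?thesis by (rule upper)
  next
    case False
    have "(\<lambda>i. - y i) \<in> topspace (nsphere n)" "0 \<le> - y 0"
      using y False by (auto simp: in_nsphere_iff)
    then obtain x where x: "x \<in> topspace (nsphere m)" "\<psi> x = (\<lambda>i. - y i)"
      using upper[of "\<lambda>i. - y i"] by blast
    have "(\<lambda>i. - x i) \<in> topspace (nsphere m)" "\<psi> (\<lambda>i. - x i) = y"
      using x odd_\<psi>[OF x(1)] by (auto simp: in_nsphere_iff)
    then show ?thesis by blast
  qed
  then have "\<psi> ` topspace (nsphere m) = topspace (nsphere n)"
    using \<psi>_in by blast
  with cont_\<psi> odd_\<psi> show ?thesis by blast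
qed

text \<open>
  The graph of \<open>w \<mapsto> 1 - \<Sum>\<^sub>j |w\<^sub>j|\<close> over the cube, traversed along the filling curve. Over the
  \<open>l\<^sup>1\<close>-ball this graph is the upper half of the unit sphere of the \<open>l\<^sup>1\<close>-norm; outside it continues
  below height \<open>0\<close>, which saves a retraction of the cube onto the ball.
\<close>
definition cap_curve :: "nat \<Rightarrow> real \<Rightarrow> nat \<Rightarrow> real" where
  "cap_curve n r i =
     (if i = 0 then 1 - (\<Sum>j=1..n. \<bar>cube_curve j r\<bar>) else if i \<le> n then cube_curve i r else 0)"

lemma continuous_on_cap_curve: "continuous_on S (\<lambda>r. cap_curve n r i)"
  unfolding cap_curve_def
  by (cases "i = 0"; cases "i \<le> n") (auto intro!: continuous_intros continuous_on_cube_curve)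

lemma cap_curve_nonzero: "\<exists>i\<le>n. cap_curve n r i \<noteq> 0"
proof (rule ccontr)
  assume "\<not> ?thesis"
  then have zero: "\<And>i. i \<le> n \<Longrightarrow> cap_curve n r i = 0" by blast
  have "cube_curve j r = 0" if "j \<in> {1..n}" for j
    using zero[of j] that by (simp add: cap_curve_def)
  then have "cap_curve n r 0 = 1" by (simp add: cap_curve_def)
  with zero[of 0] show False by simp
qed

text \<open>
  Dividing \<open>y\<close> by its \<open>l\<^sup>1\<close>-norm \<open>s\<close> moves it onto the graph: since \<open>y\<^sub>0 \<ge> 0\<close>, its height is
  \<open>y\<^sub>0 / s = 1 - \<Sum>\<^sub>j |y\<^sub>j / s|\<close>, and the remaining coordinates lie in the cube.
\<close>
lemma cap_curve_directions:
  assumes y: "y \<in> topspace (nsphere n)" "0 \<le> y 0"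
  obtains r c where "0 \<le> r" "r \<le> 1" "0 < c" "cap_curve n r = (\<lambda>i. c * y i)"
proof -
  define s where "s = y 0 + (\<Sum>j=1..n. \<bar>y j\<bar>)"
  have split: "(\<Sum>i\<le>n. f i) = f 0 + (\<Sum>j=1..n. f j)" for f :: "nat \<Rightarrow> real"
    by (simp add: sum.atMost_shift atMost_atLeast0 sum.atLeast_Suc_atMost)
  have s_alt: "s = (\<Sum>i\<le>n. \<bar>y i\<bar>)"
    using y(2) by (simp add: s_def split)
  have y0: "y i = 0" if "n < i" for i
    using y that by (simp add: in_nsphere_iff)
  have y_le: "\<bar>y i\<bar> \<le> s" for i
  proof (cases "i \<le> n")
    case True
    then show ?thesis unfolding s_alt by (intro member_le_sum) auto
  next
    case False
    then show ?thesis unfolding s_alt using y0[of i] by (simp add: sum_nonneg)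
  qed
  have "s \<noteq> 0"
  proof
    assume "s = 0"
    then have "y = (\<lambda>i. 0)" using y_le by (simp add: fun_eq_iff)
    with y(1) show False by (simp add: in_nsphere_iff)
  qed
  then have s_pos: "0 < s"
    using y_le[of 0] by linarith
  have "\<bar>y i / s\<bar> \<le> 1" for i
    using y_le[of i] s_pos by simp
  then obtain r where r: "0 \<le> r" "r \<le> 1" "\<And>i. cube_curve i r = y i / s"
    using cube_curve_onto[of "\<lambda>i. y i / s"] by metis
  have "1 - (\<Sum>j=1..n. \<bar>cube_curve j r\<bar>) = 1 - (\<Sum>j=1..n. \<bar>y j\<bar>) / s"
    using s_pos by (simp add: r(3) sum_divide_distrib)
  also have "\<dots> = 1 / s * y 0"
    using s_pos by (simp add: s_def field_simps)
  finally have "cap_curve n r = (\<lambda>i. 1 / s * y i)"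
    using y0 by (auto simp: cap_curve_def fun_eq_iff r(3))
  with r(1,2) s_pos show ?thesis by (intro that[of r "1 / s"]) auto
qed

theorem theorem5:
  fixes m n :: nat
  assumes "0 < m" and "m < n"
  shows "\<exists>\<psi> :: (nat \<Rightarrow> real) \<Rightarrow> (nat \<Rightarrow> real).
           continuous_map (nsphere m) (nsphere n) \<psi>
         \<and> \<psi> ` topspace (nsphere m) = topspace (nsphere n)
         \<and> (\<forall>x \<in> topspace (nsphere m). \<psi> (\<lambda>i. - x i) = (\<lambda>i. - \<psi> x i))"
proof -
  define F :: "(nat \<Rightarrow> real) \<Rightarrow> nat \<Rightarrow> real" where
    "F x i = max 0 (1 - 2 * \<bar>x 0\<bar>) * x i + x 0 * cap_curve n (max 0 (2 * \<bar>x 0\<bar> - 1)) i" for x i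
  show ?thesis
  proof (rule odd_surjection_by_normalization[where F = F])
    fix i
    have "continuous_map (nsphere m) euclideanreal
            ((\<lambda>r. cap_curve n r i) \<circ> (\<lambda>x. max 0 (2 * \<bar>x 0\<bar> - 1)))"
    proof (rule continuous_map_compose)
      show "continuous_map (nsphere m) euclideanreal (\<lambda>x. max 0 (2 * \<bar>x 0\<bar> - 1))"
        by (intro continuous_intros continuous_map_nsphere_projection)
    qed (simp add: continuous_on_cap_curve)
    then show "continuous_map (nsphere m) euclideanreal (\<lambda>x. F x i)"
      unfolding F_def o_def by (intro continuous_intros continuous_map_nsphere_projection)
  next
    fix x :: "nat \<Rightarrow> real" and i
    assume "x \<in> topspace (nsphere m)" "n < i"
    then show "F x i = 0"
      using assms by (simp add: F_def in_nsphere_iff cap_curve_def)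
  next
    fix x :: "nat \<Rightarrow> real"
    assume x: "x \<in> topspace (nsphere m)"
    consider "x 0 = 0" | "x 0 \<noteq> 0" "\<bar>x 0\<bar> < 1/2" | "\<bar>x 0\<bar> \<ge> 1/2" by linarith
    then show "\<exists>i\<le>n. F x i \<noteq> 0"
    proof cases
      case 1
      then have "F x = x" by (simp add: F_def fun_eq_iff)
      moreover have "\<exists>i\<le>m. x i \<noteq> 0"
      proof (rule ccontr)
        assume "\<not> ?thesis"
        then have "(\<Sum>i\<le>m. (x i)\<^sup>2) = 0" by simp
        with x show False by (simp add: in_nsphere_iff)
      qed
      ultimately show ?thesis using assms by (metis le_trans less_imp_le)
    next
      case 2
      \<comment> \<open>Here the curve rests at the pole, so both summands of \<open>F x 0\<close> have the sign of \<open>x 0\<close>.\<close>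
      then have "F x 0 = (2 - 2 * \<bar>x 0\<bar>) * x 0"
        by (simp add: F_def cap_curve_def cube_curve_0 max_def algebra_simps)
      with 2 have "F x 0 \<noteq> 0" by auto
      then show ?thesis by blast
    next
      case 3
      then have "F x i = x 0 * cap_curve n (2 * \<bar>x 0\<bar> - 1) i" for i
        by (simp add: F_def max_def)
      then show ?thesis using 3 cap_curve_nonzero[of n "2 * \<bar>x 0\<bar> - 1"] by force
    qed
  next
    fix x :: "nat \<Rightarrow> real"
    show "F (\<lambda>i. - x i) = (\<lambda>i. - F x i)"
      by (simp add: F_def fun_eq_iff)
  next
    fix y :: "nat \<Rightarrow> real"
    assume "y \<in> topspace (nsphere n)" "0 \<le> y 0"
    then obtain r c where rc: "0 \<le> r" "r \<le> 1" "0 < c" "cap_curve n r = (\<lambda>i. c * y i)"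
      by (rule cap_curve_directions)
    \<comment> \<open>At latitude \<open>t\<close> the curve parameter \<open>2 * t - 1\<close> equals \<open>r\<close> and the first summand of \<open>F\<close>
      vanishes; any point of \<open>S\<^sup>m\<close> at that latitude is a preimage.\<close>
    define t where "t = (1 + r) / 2"
    define x :: "nat \<Rightarrow> real" where
      "x i = (if i = 0 then t else if i = 1 then sqrt (1 - t\<^sup>2) else 0)" for i
    have t: "1/2 \<le> t" "t \<le> 1" using rc by (auto simp: t_def)
    then have "t\<^sup>2 \<le> 1" by (simp add: power_le_one)
    have "(\<Sum>i\<le>m. (x i)\<^sup>2) = (\<Sum>i\<in>{0,1}. (x i)\<^sup>2)"
      using \<open>0 < m\<close> by (intro sum.mono_neutral_right) (auto simp: x_def)
    also have "\<dots> = 1" using \<open>t\<^sup>2 \<le> 1\<close> by (simp add: x_def)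
    finally have "x \<in> topspace (nsphere m)"
      using \<open>0 < m\<close> by (auto simp: in_nsphere_iff x_def)
    moreover have "F x = (\<lambda>i. (t * c) * y i)"
    proof
      fix i
      have "2 * t - 1 = r" by (simp add: t_def field_simps)
      then show "F x i = (t * c) * y i"
        using t rc by (simp add: F_def x_def[of 0] max_def)
    qed
    moreover have "0 < t * c" using t rc(3) by simp
    ultimately show "\<exists>x \<in> topspace (nsphere m). \<exists>c>0. F x = (\<lambda>i. c * y i)"
      by blast
  qed
qed

end
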